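(* Consider the cutting-plane algorithm which, in every round $t$, queries the center of a John ellipsoid of the current knowledge set $K_t$. For every $T$, every hidden point $w^*\in\mathsf{B}$ and every (strong) separation oracle, this algorithm incurs regret at most $\exp(O(d\log d))$, where the implied constant is absolute (in particular the bound does not depend on $T$).
   Context: $\mathsf{B}=\{w\in\mathbb{R}^d:\|w\|_2\le 1\}$. Cutting-plane problem: there is a hidden $w^*\in\mathsf{B}$. In each round $t=1,\dots,T$ the learner queries a point $p_t$, and a (strong) separation oracle returns a unit vector $v_t$, chosen adversarially and possibly depending on $p_t$ and on the history, such that $\langle w^*,v_t\rangle\ge\langle p_t,v_t\rangle$. The regret is $\sum_{t=1}^T\langle w^*-p_t,v_t\rangle$. The knowledge set is $K_1=\mathsf{B}$ and $K_{t+1}=K_t\cap\{w:\langle w-p_t,v_t\rangle\ge 0\}$. A John ellipsoid of a convex set $K$ is a set $E=A^{-1}(q+\mathsf{B})$, where $q\in\mathbb{R}^d$ and $A$ is an invertible linear map with $q+\mathsf{B}\subseteq A(K)\subseteq q+d\mathsf{B}$; its center is $A^{-1}q$. *)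

theory Defs
  imports Complex_Main "Jordan_Normal_Form.Matrix"
begin

definition vnorm :: "real vec \<Rightarrow> real" where
  "vnorm x = sqrt (x \<bullet> x)"

definition cball_d :: "nat \<Rightarrow> real vec \<Rightarrow> real \<Rightarrow> real vec set" where
  "cball_d d c r = {x \<in> carrier_vec d. vnorm (x - c) \<le> r}"

definition unit_ball :: "nat \<Rightarrow> real vec set" where
  "unit_ball d = cball_d d (0\<^sub>v d) 1"

text \<open>p is the center of a John ellipsoid E = A^{-1}(q + B) of K:
  A invertible linear, q + B \<subseteq> A(K) \<subseteq> q + d B, and p = A^{-1} q (i.e. A p = q).\<close>
definition john_center :: "nat \<Rightarrow> real vec set \<Rightarrow> real vec \<Rightarrow> bool" where
  "john_center d K p \<longleftrightarrow> p \<in> carrier_vec d \<and>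
     (\<exists>A q. A \<in> carrier_mat d d \<and> invertible_mat A \<and> q \<in> carrier_vec d \<and>
        cball_d d q 1 \<subseteq> (\<lambda>x. A *\<^sub>v x) ` K \<and>
        (\<lambda>x. A *\<^sub>v x) ` K \<subseteq> cball_d d q (real d) \<and>
        A *\<^sub>v p = q)"

text \<open>Knowledge set K_t (t \<ge> 1): K_1 = B, K_{t+1} = K_t \<inter> {w. <w - p_t, v_t> \<ge> 0},
  written in unrolled form.\<close>
definition knowledge :: "nat \<Rightarrow> (nat \<Rightarrow> real vec) \<Rightarrow> (nat \<Rightarrow> real vec) \<Rightarrow> nat \<Rightarrow> real vec set" where
  "knowledge d p v t = unit_ball d \<inter> {w. \<forall>s\<in>{1..<t}. (w - p s) \<bullet> v s \<ge> 0}"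

definition regret :: "nat \<Rightarrow> real vec \<Rightarrow> (nat \<Rightarrow> real vec) \<Rightarrow> (nat \<Rightarrow> real vec) \<Rightarrow> real" where
  "regret T w p v = (\<Sum>t=1..T. (w - p t) \<bullet> v t)"

end

theory Submission
  imports Defs "HOL-Analysis.L2_Norm"
begin

text \<open>
  Fix a scale \<open>e\<close> and put \<open>r = e / (8d)\<close>. The potential is the number of points of a fine grid
  within distance \<open>r\<close> of the knowledge set, a discrete volume of \<open>K + r B\<close>. In a round with loss
  at least \<open>e\<close>, the point \<open>p + (\<plusminus>(k - p) - (w - p)) / (2d)\<close> lies in \<open>K\<close> for every \<open>k \<in> K\<close>, since
  the John ellipsoid is symmetric and convex and its dilation by \<open>d\<close> contains \<open>K\<close>. Choosing the sign so that
  \<open>\<plusminus>(k - p)\<close> does not point along \<open>v\<close>, one lands at depth \<open>e / (2d) = 4r\<close> on the discarded side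
  of the cut. This contraction by \<open>2d\<close>, rounded to the grid, maps the counted grid points to lost
  ones with fibres of size at most \<open>2 (2d)^d\<close>. Hence the potential loses a fixed fraction, and at most
  \<open>2 (2d)^d d ln (65 d^2 / e)\<close> rounds have loss at least \<open>e\<close>. As this grows only logarithmically
  in \<open>1 / e\<close>, summing over the scales \<open>e = 2^-i\<close> gives a bound free of \<open>T\<close>.
\<close>

section \<open>Euclidean norm on vectors\<close>

lemma vnorm_eq_L2_set:
  assumes "x \<in> carrier_vec d"
  shows "vnorm x = L2_set (\<lambda>i. x $ i) {..<d}"
  using assms unfolding vnorm_def L2_set_def scalar_prod_def
  by (auto simp: power2_eq_square lessThan_atLeast0)

lemma vnorm_cong:
  assumes "x \<in> carrier_vec d" "y \<in> carrier_vec d" "\<And>i. i < d \<Longrightarrow> x $ i = y $ i"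
  shows "vnorm x = vnorm y"
  using assms by (metis eq_vecI carrier_vecD)

lemma vnorm_add_le:
  assumes "x \<in> carrier_vec d" "y \<in> carrier_vec d"
  shows "vnorm (x + y) \<le> vnorm x + vnorm y"
proof -
  have "vnorm (x + y) = L2_set (\<lambda>i. x $ i + y $ i) {..<d}"
    using assms by (subst vnorm_eq_L2_set[of _ d]) (auto intro!: L2_set_cong)
  also have "\<dots> \<le> vnorm x + vnorm y"
    using L2_set_triangle_ineq assms by (simp add: vnorm_eq_L2_set)
  finally show ?thesis .
qed

lemma vnorm_smult:
  assumes "x \<in> carrier_vec d"
  shows "vnorm (c \<cdot>\<^sub>v x) = \<bar>c\<bar> * vnorm x"
proof -
  have "vnorm (c \<cdot>\<^sub>v x) = L2_set (\<lambda>i. c * x $ i) {..<d}"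
    using assms by (subst vnorm_eq_L2_set[of _ d]) (auto intro!: L2_set_cong)
  also have "\<dots> = sqrt (c\<^sup>2 * (\<Sum>i<d. (x $ i)\<^sup>2))"
    by (simp add: L2_set_def power_mult_distrib sum_distrib_left)
  also have "\<dots> = \<bar>c\<bar> * vnorm x"
    using assms by (simp add: vnorm_eq_L2_set L2_set_def real_sqrt_mult)
  finally show ?thesis .
qed

lemma vnorm_minus_commute:
  assumes "x \<in> carrier_vec d" "y \<in> carrier_vec d"
  shows "vnorm (x - y) = vnorm (y - x)"
proof -
  have "vnorm (x - y) = vnorm ((-1) \<cdot>\<^sub>v (y - x))"
    using assms by (intro vnorm_cong[of _ d]) auto
  then show ?thesis using assms vnorm_smult[of "y - x" d "-1"] by simp
qed

lemma scalar_prod_le_vnorm: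
  assumes "x \<in> carrier_vec d" "y \<in> carrier_vec d"
  shows "x \<bullet> y \<le> vnorm x * vnorm y"
proof -
  have "x \<bullet> y \<le> (\<Sum>i<d. \<bar>x $ i\<bar> * \<bar>y $ i\<bar>)"
    using assms unfolding scalar_prod_def
    by (auto simp: lessThan_atLeast0 abs_mult[symmetric] intro!: sum_mono)
  also have "\<dots> \<le> vnorm x * vnorm y"
    using L2_set_mult_ineq assms by (simp add: vnorm_eq_L2_set)
  finally show ?thesis .
qed

text \<open>Passing through the l1 norm costs a factor \<open>d\<close> in place of
  \<open>sqrt d\<close>; the grid width is later chosen to absorb it.\<close>

lemma vnorm_le_coordinates:
  assumes "x \<in> carrier_vec d" "\<And>i. i < d \<Longrightarrow> \<bar>x $ i\<bar> \<le> b"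
  shows "vnorm x \<le> real d * b"
proof -
  have "vnorm x \<le> (\<Sum>i<d. \<bar>x $ i\<bar>)"
    using assms by (simp add: vnorm_eq_L2_set L2_set_le_sum_abs)
  also have "\<dots> \<le> (\<Sum>i<d. b)" using assms(2) by (intro sum_mono) auto
  finally show ?thesis by simp
qed

lemma abs_coordinate_le_vnorm:
  assumes "x \<in> carrier_vec d" "i < d"
  shows "\<bar>x $ i\<bar> \<le> vnorm x"
proof -
  have "L2_set (\<lambda>i. \<bar>x $ i\<bar>) {..<d} = vnorm x"
    using assms by (simp add: vnorm_eq_L2_set L2_set_def)
  then show ?thesis using member_le_L2_set[of "{..<d}" i "\<lambda>i. \<bar>x $ i\<bar>"] assms by simp
qed

section \<open>Geometry of the John center\<close>

text \<open>\<open>A\<close> sends \<open>x - p\<close> and \<open>y - p\<close> to vectors of norm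
  at most \<open>d\<close>, so the combination has image of norm at most 1 and stays in the inner
  ball around \<open>q\<close>. The coefficients may be negative, which allows reflection through
  \<open>p\<close>.\<close>

lemma john_center_combination:
  assumes "john_center d K p" "K \<subseteq> carrier_vec d" "x \<in> K" "y \<in> K"
    and ab: "(\<bar>a\<bar> + \<bar>b\<bar>) * real d \<le> 1"
  shows "p + (a \<cdot>\<^sub>v (x - p) + b \<cdot>\<^sub>v (y - p)) \<in> K"
proof -
  obtain A q where A: "A \<in> carrier_mat d d" "invertible_mat A" and q: "q \<in> carrier_vec d"
    and sub: "cball_d d q 1 \<subseteq> (\<lambda>x. A *\<^sub>v x) ` K"
    and sup: "(\<lambda>x. A *\<^sub>v x) ` K \<subseteq> cball_d d q (real d)"
    and Ap: "A *\<^sub>v p = q" and p: "p \<in> carrier_vec d"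
    using assms(1) unfolding john_center_def by blast
  have xy: "x \<in> carrier_vec d" "y \<in> carrier_vec d" using assms by auto
  let ?z = "a \<cdot>\<^sub>v (x - p) + b \<cdot>\<^sub>v (y - p)"
  have dev: "A *\<^sub>v (u - p) \<in> carrier_vec d \<and> vnorm (A *\<^sub>v (u - p)) \<le> d" if "u \<in> K" for u
  proof -
    have u: "u \<in> carrier_vec d" using that assms(2) by auto
    have "A *\<^sub>v u \<in> cball_d d q (real d)" using sup that by auto
    then have "vnorm (A *\<^sub>v u - q) \<le> d" by (simp add: cball_d_def)
    moreover have "A *\<^sub>v (u - p) = A *\<^sub>v u - q"
      using A u p Ap by (simp add: mult_minus_distrib_mat_vec)
    moreover have "A *\<^sub>v (u - p) \<in> carrier_vec d" using A u p by simp
    ultimately show ?thesis by simp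
  qed
  have zc: "?z \<in> carrier_vec d" using xy p by simp
  have Az: "A *\<^sub>v ?z = a \<cdot>\<^sub>v (A *\<^sub>v (x - p)) + b \<cdot>\<^sub>v (A *\<^sub>v (y - p))"
    using A xy p by (simp add: mult_add_distrib_mat_vec[of A d d] mult_mat_vec[of A d d])
  have "vnorm (A *\<^sub>v ?z) \<le> \<bar>a\<bar> * vnorm (A *\<^sub>v (x - p)) + \<bar>b\<bar> * vnorm (A *\<^sub>v (y - p))"
    unfolding Az using dev assms(3,4)
    by (metis vnorm_add_le vnorm_smult smult_carrier_vec)
  also have "\<dots> \<le> \<bar>a\<bar> * d + \<bar>b\<bar> * d"
    using dev assms(3,4) by (intro add_mono mult_left_mono) auto
  also have "\<dots> \<le> 1" using ab by (simp add: algebra_simps)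
  finally have n1: "vnorm (A *\<^sub>v ?z) \<le> 1" .
  have Apz: "A *\<^sub>v (p + ?z) = q + A *\<^sub>v ?z"
    using A p zc Ap by (simp add: mult_add_distrib_mat_vec[of A d d])
  have "q + A *\<^sub>v ?z - q = A *\<^sub>v ?z" using q A zc by (intro eq_vecI) auto
  then have "A *\<^sub>v (p + ?z) \<in> cball_d d q 1"
    unfolding Apz cball_d_def using n1 q A zc by simp
  then obtain k where k: "k \<in> K" "A *\<^sub>v k = A *\<^sub>v (p + ?z)" using sub by force
  obtain B where B: "inverts_mat B A" "inverts_mat A B" using A unfolding invertible_mat_def by blast
  \<comment> \<open>\<open>inverts_mat\<close> does not prescribe the shape of \<open>B\<close>;
    comparing dimensions in both product identities does.\<close>
  have Bc: "B \<in> carrier_mat d d"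
    using A B unfolding inverts_mat_def
    by (metis carrier_matD(1) carrier_matI index_mult_mat(2,3) index_one_mat(2,3) carrier_matD(2))
  have BA: "B * A = 1\<^sub>m d" using B Bc by (simp add: inverts_mat_def)
  have inv: "B *\<^sub>v (A *\<^sub>v u) = u" if "u \<in> carrier_vec d" for u
    using that A Bc BA by (metis assoc_mult_mat_vec one_mult_mat_vec)
  have "k = p + ?z" using inv k assms(2) zc p by (metis add_carrier_vec subsetD)
  then show ?thesis using k by simp
qed

section \<open>Grid points near a set\<close>

definition grid_point :: "nat \<Rightarrow> real \<Rightarrow> (nat \<Rightarrow> int) \<Rightarrow> real vec" where
  "grid_point d h z = vec d (\<lambda>i. h * of_int (z i))"

text \<open>Restricting to \<open>{..<d}\<close> makes the index function extensional, so distinct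
  functions stand for distinct grid points and cardinalities count points.\<close>

definition grid_round :: "nat \<Rightarrow> real \<Rightarrow> real vec \<Rightarrow> nat \<Rightarrow> int" where
  "grid_round d h x = (\<lambda>i\<in>{..<d}. \<lfloor>x $ i / h\<rfloor>)"

definition grid_nbhd :: "nat \<Rightarrow> real \<Rightarrow> real \<Rightarrow> real vec set \<Rightarrow> (nat \<Rightarrow> int) set" where
  "grid_nbhd d h r K = {z \<in> {..<d} \<rightarrow>\<^sub>E UNIV. \<exists>k\<in>K. vnorm (grid_point d h z - k) \<le> r}"

lemma grid_point_carrier [simp]: "grid_point d h z \<in> carrier_vec d"
  by (simp add: grid_point_def)

lemma grid_round_PiE: "grid_round d h x \<in> {..<d} \<rightarrow>\<^sub>E UNIV"
  by (simp add: grid_round_def)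

lemma vnorm_grid_round:
  assumes "x \<in> carrier_vec d" "h > 0"
  shows "vnorm (grid_point d h (grid_round d h x) - x) \<le> real d * h"
proof (rule vnorm_le_coordinates)
  show "grid_point d h (grid_round d h x) - x \<in> carrier_vec d" using assms by simp
  fix i assume i: "i < d"
  have "h * (x $ i / h) < h * (real_of_int \<lfloor>x $ i / h\<rfloor> + 1)"
    using assms(2) by (intro mult_strict_left_mono) linarith+
  moreover have "h * real_of_int \<lfloor>x $ i / h\<rfloor> \<le> h * (x $ i / h)"
    using assms(2) by (intro mult_left_mono) auto
  ultimately have "x $ i - h < h * real_of_int \<lfloor>x $ i / h\<rfloor>" "h * real_of_int \<lfloor>x $ i / h\<rfloor> \<le> x $ i"
    using assms(2) by (simp_all add: algebra_simps)
  then show "\<bar>(grid_point d h (grid_round d h x) - x) $ i\<bar> \<le> h"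
    using i assms by (simp add: grid_point_def grid_round_def)
qed

lemma grid_nbhd_mono: "K \<subseteq> L \<Longrightarrow> grid_nbhd d h r K \<subseteq> grid_nbhd d h r L"
  by (auto simp: grid_nbhd_def)

text \<open>The rounding of \<open>x\<close> is a witness. Counts are thus at least 1 and their
  logarithms nonnegative.\<close>

lemma grid_nbhd_nonempty:
  assumes "x \<in> K" "x \<in> carrier_vec d" "h > 0" "real d * h \<le> r"
  shows "grid_nbhd d h r K \<noteq> {}"
  using vnorm_grid_round[of x d h] grid_round_PiE[of d h x] assms
  unfolding grid_nbhd_def by force

text \<open>A point within 1 of the unit ball has coordinates of absolute value at most 2, hence
  integer coordinates between \<open>-2/h\<close> and \<open>2/h\<close>.\<close>

lemma grid_nbhd_unit_ball:
  assumes h: "h > 0" and r: "r \<le> 1"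
  shows "finite (grid_nbhd d h r (unit_ball d))"
    and "card (grid_nbhd d h r (unit_ball d)) \<le> (4 / h + 1) ^ d"
proof -
  let ?B = "{..<d} \<rightarrow>\<^sub>E {- \<lfloor>2 / h\<rfloor>..\<lfloor>2 / h\<rfloor>}"
  have sub: "grid_nbhd d h r (unit_ball d) \<subseteq> ?B"
  proof
    fix z assume "z \<in> grid_nbhd d h r (unit_ball d)"
    then obtain k where z: "z \<in> {..<d} \<rightarrow>\<^sub>E UNIV" and k: "k \<in> unit_ball d"
      and dk: "vnorm (grid_point d h z - k) \<le> r" by (auto simp: grid_nbhd_def)
    have kc: "k \<in> carrier_vec d" "vnorm k \<le> 1"
      using k by (auto simp: unit_ball_def cball_d_def)
    have "z i \<in> {- \<lfloor>2 / h\<rfloor>..\<lfloor>2 / h\<rfloor>}" if i: "i < d" for i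
    proof -
      have "\<bar>k $ i\<bar> \<le> 1" using abs_coordinate_le_vnorm[OF kc(1) i] kc(2) by simp
      moreover have "\<bar>(grid_point d h z - k) $ i\<bar> \<le> 1"
        using abs_coordinate_le_vnorm[of "grid_point d h z - k" d i] kc i dk r by simp
      ultimately have "\<bar>h * real_of_int (z i)\<bar> \<le> 2"
        using kc i by (simp add: grid_point_def)
      then have "real_of_int \<bar>z i\<bar> \<le> 2 / h" using h by (simp add: abs_mult field_simps)
      then have "\<bar>z i\<bar> \<le> \<lfloor>2 / h\<rfloor>" by (simp add: le_floor_iff)
      then show ?thesis by auto
    qed
    then show "z \<in> ?B" using z by (auto simp: PiE_iff)
  qed
  have fin: "finite ?B" by (intro finite_PiE) auto
  then show "finite (grid_nbhd d h r (unit_ball d))" using sub by (rule rev_finite_subset)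
  have "0 \<le> \<lfloor>2 / h\<rfloor>" using h by simp
  then have "real (card {- \<lfloor>2 / h\<rfloor>..\<lfloor>2 / h\<rfloor>}) = 2 * of_int \<lfloor>2 / h\<rfloor> + 1" by simp
  also have "\<dots> \<le> 4 / h + 1" using of_int_floor_le[of "2 / h"] by linarith
  finally have "real (card {- \<lfloor>2 / h\<rfloor>..\<lfloor>2 / h\<rfloor>}) \<le> 4 / h + 1" .
  then have "real (card ?B) \<le> (4 / h + 1) ^ d"
    by (simp add: card_PiE power_mono del: card_atLeastAtMost_int)
  moreover have "card (grid_nbhd d h r (unit_ball d)) \<le> card ?B"
    using sub fin by (rule card_mono[rotated])
  ultimately show "card (grid_nbhd d h r (unit_ball d)) \<le> (4 / h + 1) ^ d" by linarith
qed

section \<open>Dyadic decomposition of a loss\<close>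

lemma sum_power_half: "(\<Sum>i\<le>M. (real i + 1) * 2 / 2 ^ i) \<le> 8"
proof -
  \<comment> \<open>The closed form with its exact remainder is what makes the induction go
    through.\<close>
  have "(\<Sum>i\<le>M. (real i + 1) * 2 / 2 ^ i) = 8 - (2 * real M + 6) / 2 ^ M"
    by (induction M) (auto simp: field_simps)
  then show ?thesis by simp
qed

text \<open>The coarsest scale \<open>1 / 2 ^ i\<close> not exceeding \<open>x\<close> contributes
  \<open>2 / 2 ^ i\<close>, which is already at least \<open>x\<close>; if no scale up to
  \<open>M\<close> qualifies, the last term covers \<open>x\<close>. Summed over rounds, this
  reduces regret to counting rounds per scale.\<close>

lemma dyadic_bound:
  fixes x :: real
  assumes "x \<le> 2"
  shows "x \<le> (\<Sum>i\<le>M. if x \<ge> 1 / 2 ^ i then 2 / 2 ^ i else 0) + 1 / 2 ^ M"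
proof -
  let ?S = "\<lambda>M. \<Sum>i\<le>M. if x \<ge> 1 / 2 ^ i then 2 / 2 ^ i else (0::real)"
  have "x \<ge> 1 / 2 ^ M \<Longrightarrow> x \<le> ?S M"
  proof (induction M)
    case (Suc M)
    have nn: "?S M \<ge> 0" by (intro sum_nonneg) auto
    show ?case
    \<comment> \<open>Either the induction hypothesis applies, or \<open>x < 1 / 2 ^ M\<close> and
      the new term, equal to \<open>1 / 2 ^ M\<close>, suffices alone.\<close>
    proof (cases "x \<ge> 1 / 2 ^ M")
      case True
      then show ?thesis using Suc.IH Suc.prems by (simp add: add_increasing2)
    next
      case False
      then show ?thesis using Suc.prems nn by simp
    qed
  qed (use assms in simp)
  moreover have "?S M \<ge> 0" by (intro sum_nonneg) auto
  ultimately show ?thesis by (cases "x \<ge> 1 / 2 ^ M") (auto simp: add_increasing2)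
qed


section \<open>Loss of grid points under one cut\<close>

text \<open>
  Equal roundings force coordinates to differ by less than \<open>2d\<close>, so the residues modulo \<open>2d\<close>
  recover the grid point; this bounds the fibres of the contraction.
\<close>

lemma grid_round_affine_eq:
  assumes d: "d \<ge> 1" and h: "h > 0" and c: "c \<in> carrier_vec d" and s: "\<bar>s\<bar> = 1"
    and x: "x \<in> {..<d} \<rightarrow>\<^sub>E UNIV" and y: "y \<in> {..<d} \<rightarrow>\<^sub>E UNIV"
    and eq: "grid_round d h (c + (s / (2 * real d)) \<cdot>\<^sub>v grid_point d h x) =
             grid_round d h (c + (s / (2 * real d)) \<cdot>\<^sub>v grid_point d h y)"
    and res: "\<And>i. i < d \<Longrightarrow> x i mod (2 * int d) = y i mod (2 * int d)"
  shows "x = y"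
proof (rule PiE_ext[OF x y])
  fix i assume "i \<in> {..<d}"
  then have i: "i < d" by simp
  let ?a = "\<lambda>x. c $ i / h + s * real_of_int (x i) / (2 * real d)"
  have "\<lfloor>(c + (s / (2 * real d)) \<cdot>\<^sub>v grid_point d h x) $ i / h\<rfloor> =
        \<lfloor>(c + (s / (2 * real d)) \<cdot>\<^sub>v grid_point d h y) $ i / h\<rfloor>"
    using fun_cong[OF eq, of i] i by (simp add: grid_round_def)
  moreover have "(c + (s / (2 * real d)) \<cdot>\<^sub>v grid_point d h z) $ i / h = ?a z" for z
    using i c h d by (simp add: grid_point_def field_simps)
  ultimately have "\<lfloor>?a x\<rfloor> = \<lfloor>?a y\<rfloor>" by simp
  then have "\<bar>?a x - ?a y\<bar> < 1" by linarith
  also have "?a x - ?a y = s * (real_of_int (x i - y i) / (2 * real d))"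
    using d by (simp add: diff_divide_distrib right_diff_distrib)
  finally have "real_of_int \<bar>x i - y i\<bar> < real_of_int (2 * int d)"
    using s d by (simp add: abs_mult pos_divide_less_eq mult.commute)
  then have "\<bar>x i - y i\<bar> < 2 * int d" by linarith
  moreover have "2 * int d dvd x i - y i" using res[OF i] by (simp add: mod_eq_dvd_iff)
  ultimately show "x i = y i" using zdvd_not_zless[of "\<bar>x i - y i\<bar>" "2 * int d"] by force
qed

text \<open>A counted grid point is determined by its rounded image, the sign used and its residues
  modulo \<open>2d\<close>. The image is a lost point, the sign gives the factor 2 and the residues
  give \<open>(2 * d) ^ d\<close>.\<close>

lemma grid_nbhd_cut:
  assumes d: "d \<ge> 1" and r: "r > 0" and h: "h = r / (2 * real d)"
    and K: "K \<subseteq> carrier_vec d" and john: "john_center d K p"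
    and fin: "finite (grid_nbhd d h r K)"
    and w: "w \<in> K" and v: "v \<in> carrier_vec d" "vnorm v = 1"
    and gap: "(w - p) \<bullet> v \<ge> 8 * real d * r"
  shows "card (grid_nbhd d h r K) \<le> 2 * (2 * d) ^ d *
           card (grid_nbhd d h r K - grid_nbhd d h r {k \<in> K. (k - p) \<bullet> v \<ge> 0})"
proof -
  let ?G = "grid_nbhd d h r K" and ?G' = "grid_nbhd d h r {k \<in> K. (k - p) \<bullet> v \<ge> 0}"
  let ?b = "1 / (2 * real d)"
  have p: "p \<in> carrier_vec d" using john by (simp add: john_center_def)
  have wc: "w \<in> carrier_vec d" using w K by auto
  have h0: "h > 0" using h r d by simp
  have dh: "real d * h = r / 2" using h d by simp
  define up where "up x \<longleftrightarrow> (grid_point d h x - p) \<bullet> v \<ge> 0" for x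
  define s where "s b = (if b then -1 else 1 :: real)" for b
  \<comment> \<open>Two weights of absolute value \<open>1 / (2d)\<close> exhaust the budget
    \<open>(\<bar>a\<bar> + \<bar>b\<bar>) * d \<le> 1\<close> of
    \<open>john_center_combination\<close>.\<close>
  define y where
    "y b u = p + ((s b / (2 * real d)) \<cdot>\<^sub>v (u - p) + (- ?b) \<cdot>\<^sub>v (w - p))" for b u
  define f where "f x = grid_round d h (y (up x) (grid_point d h x))" for x
  define \<phi> where "\<phi> x = (f x, up x, \<lambda>i\<in>{..<d}. x i mod (2 * int d))" for x :: "nat \<Rightarrow> int"
  have abs_s: "\<bar>s b\<bar> = 1" for b by (simp add: s_def)
  have yc: "y b u \<in> carrier_vec d" if "u \<in> carrier_vec d" for b u
    using that p wc by (simp add: y_def)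
  have f_in: "f x \<in> ?G - ?G'" if x: "x \<in> ?G" for x
  proof -
    let ?x = "grid_point d h x" let ?y = "y (up x) ?x" let ?f = "grid_point d h (f x)"
    obtain k where k: "k \<in> K" "vnorm (?x - k) \<le> r" using x by (auto simp: grid_nbhd_def)
    have kc: "k \<in> carrier_vec d" using k K by auto
    \<comment> \<open>The allowance \<open>r\<close> is split evenly: rounding costs at most
      \<open>d * h = r / 2\<close>, and the contraction shrinks the distance from \<open>?x\<close>
      to \<open>k\<close> to at most \<open>r / (2d)\<close>.\<close>
    have round: "vnorm (?f - ?y) \<le> r / 2"
      using vnorm_grid_round[of ?y d h] yc[of ?x "up x"] h0 dh by (simp add: f_def)
    have yk: "y (up x) k \<in> K"
      unfolding y_def using john K k(1) w
    proof (rule john_center_combination)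
      show "(\<bar>s (up x) / (2 * real d)\<bar> + \<bar>- ?b\<bar>) * real d \<le> 1"
        using d abs_s by (simp add: field_simps)
    qed
    have "?y - y (up x) k = (s (up x) / (2 * real d)) \<cdot>\<^sub>v (?x - k)"
      using p wc kc by (intro eq_vecI) (auto simp: y_def algebra_simps diff_divide_distrib)
    then have "vnorm (?y - y (up x) k) = ?b * vnorm (?x - k)"
      using kc by (simp add: vnorm_smult[of _ d] abs_s)
    also have "\<dots> \<le> ?b * r" using k(2) by (intro mult_left_mono) auto
    also have "\<dots> \<le> r / 2" using d r by (simp add: field_simps)
    finally have near: "vnorm (?y - y (up x) k) \<le> r / 2" .
    have "?f - y (up x) k = (?f - ?y) + (?y - y (up x) k)"
      using yc[of ?x "up x"] yc[OF kc, of "up x"] by (intro eq_vecI) auto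
    then have "vnorm (?f - y (up x) k) \<le> vnorm (?f - ?y) + vnorm (?y - y (up x) k)"
      using vnorm_add_le[of "?f - ?y" d "?y - y (up x) k"] yc[of ?x "up x"] yc[OF kc, of "up x"]
      by simp
    then have "vnorm (?f - y (up x) k) \<le> r" using round near by linarith
    then have "f x \<in> ?G" using yk grid_round_PiE unfolding grid_nbhd_def f_def by blast
    moreover have "f x \<notin> ?G'"
    proof
      assume "f x \<in> ?G'"
      then obtain k' where k': "k' \<in> K" "(k' - p) \<bullet> v \<ge> 0" "vnorm (?f - k') \<le> r"
        by (auto simp: grid_nbhd_def)
      have k'c: "k' \<in> carrier_vec d" using k' K by auto
      \<comment> \<open>Along \<open>v\<close> the three parts contribute at most \<open>r\<close>,
        \<open>r / 2\<close> and \<open>-4 * r\<close>, so \<open>k'\<close> would lie strictly on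
        the discarded side.\<close>
      have "k' - p = (k' - ?f) + ((?f - ?y) + (?y - p))"
        using k'c p yc[OF grid_point_carrier, of "up x" h x] grid_point_carrier[of d h "f x"]
        by (intro eq_vecI) (auto simp del: grid_point_carrier)
      then have "(k' - p) \<bullet> v = (k' - ?f) \<bullet> v + ((?f - ?y) \<bullet> v + (?y - p) \<bullet> v)"
        using k'c p yc[of ?x "up x"] v by (simp add: add_scalar_prod_distrib[of _ d])
      moreover have "(k' - ?f) \<bullet> v \<le> r"
        using scalar_prod_le_vnorm[of "k' - ?f" d v] k' k'c v vnorm_minus_commute[of k' d ?f] by simp
      moreover have "(?f - ?y) \<bullet> v \<le> r / 2"
        using scalar_prod_le_vnorm[of "?f - ?y" d v] round yc[of ?x "up x"] v by simp
      moreover have "(?y - p) \<bullet> v \<le> - 4 * r"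
      proof -
        have "?y - p = (s (up x) / (2 * real d)) \<cdot>\<^sub>v (?x - p) + (- ?b) \<cdot>\<^sub>v (w - p)"
          using p wc by (intro eq_vecI) (auto simp: y_def)
        then have "(?y - p) \<bullet> v = ?b * (s (up x) * ((?x - p) \<bullet> v)) - ?b * ((w - p) \<bullet> v)"
          using p wc v by (simp add: add_scalar_prod_distrib[of _ d])
        \<comment> \<open>The sign was chosen for this: it is \<open>-1\<close> exactly when
          \<open>?x - p\<close> has nonnegative product with \<open>v\<close>.\<close>
        moreover have "?b * (s (up x) * ((?x - p) \<bullet> v)) \<le> 0"
          by (rule mult_nonneg_nonpos) (auto simp: s_def up_def)
        moreover have "?b * ((w - p) \<bullet> v) \<ge> ?b * (8 * real d * r)"
          using gap by (intro mult_left_mono) auto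
        moreover have "?b * (8 * real d * r) = 4 * r" using d by simp
        ultimately show ?thesis by linarith
      qed
      ultimately show False using k'(2) r by linarith
    qed
    ultimately show ?thesis by blast
  qed
  have inj: "inj_on \<phi> ?G"
  proof (rule inj_onI)
    fix x z assume xz: "x \<in> ?G" "z \<in> ?G" and eq: "\<phi> x = \<phi> z"
    have up: "up x = up z" using eq by (simp add: \<phi>_def)
    \<comment> \<open>For a fixed sign, \<open>y\<close> is affine with linear part plus or minus
      \<open>1 / (2d)\<close>; \<open>?c\<close> collects the constant part.\<close>
    let ?c = "p + ((- (s (up z) / (2 * real d))) \<cdot>\<^sub>v p + (- ?b) \<cdot>\<^sub>v (w - p))"
    have y_aff: "y (up z) (grid_point d h u) = ?c + (s (up z) / (2 * real d)) \<cdot>\<^sub>v grid_point d h u" for u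
      using p wc by (intro eq_vecI) (auto simp: y_def algebra_simps diff_divide_distrib grid_point_def)
    show "x = z"
    proof (rule grid_round_affine_eq[OF d h0 _ abs_s])
      show "grid_round d h (?c + (s (up z) / (2 * real d)) \<cdot>\<^sub>v grid_point d h x) =
            grid_round d h (?c + (s (up z) / (2 * real d)) \<cdot>\<^sub>v grid_point d h z)"
        using eq up unfolding \<phi>_def f_def y_aff[symmetric] by simp
      show "x i mod (2 * int d) = z i mod (2 * int d)" if "i < d" for i
      proof -
        have "(\<lambda>i\<in>{..<d}. x i mod (2 * int d)) i = (\<lambda>i\<in>{..<d}. z i mod (2 * int d)) i"
          using eq unfolding \<phi>_def by (metis prod.inject)
        then show ?thesis using that by simp
      qed
      show "?c \<in> carrier_vec d" using p wc by simp
    qed (use xz in \<open>auto simp: grid_nbhd_def\<close>)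
  qed
  let ?R = "(?G - ?G') \<times> (UNIV :: bool set) \<times> ({..<d} \<rightarrow>\<^sub>E {0..<2 * int d})"
  have "\<phi> ` ?G \<subseteq> ?R" using f_in d by (auto simp: \<phi>_def PiE_iff split: if_splits)
  moreover have "finite ?R" using fin by (intro finite_cartesian_product finite_PiE) auto
  ultimately have "card ?G \<le> card ?R" using inj by (intro card_inj_on_le)
  also have "\<dots> = 2 * (2 * d) ^ d * card (?G - ?G')"
    by (simp add: card_cartesian_product card_PiE nat_mult_distrib)
  finally show ?thesis .
qed

section \<open>Counting the rounds with large loss\<close>

lemma knowledge_Suc:
  "t \<ge> 1 \<Longrightarrow> knowledge d p v (Suc t) = {k \<in> knowledge d p v t. (k - p t) \<bullet> v t \<ge> 0}"
  by (auto simp: knowledge_def less_Suc_eq)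

lemma knowledge_subset_unit_ball: "knowledge d p v t \<subseteq> unit_ball d"
  by (auto simp: knowledge_def)

lemma unit_ball_subset_carrier: "unit_ball d \<subseteq> carrier_vec d"
  by (auto simp: unit_ball_def cball_d_def)

text \<open>With \<open>Q\<close> the factor from \<open>grid_nbhd_cut\<close>, each such round
  multiplies the count \<open>N\<close> by at most \<open>1 - 1 / Q\<close>. So \<open>ln N\<close>
  drops by at least \<open>1 / Q\<close>, while it starts at most at
  \<open>d ln (65 d^2 / e)\<close> and never becomes negative.\<close>

lemma card_large_losses:
  fixes d T :: nat
  assumes d: "d \<ge> 1" and w: "w \<in> unit_ball d"
    and rounds: "\<And>t. t \<in> {1..T} \<Longrightarrow> john_center d (knowledge d p v t) (p t) \<and>
                  v t \<in> carrier_vec d \<and> vnorm (v t) = 1 \<and> (w - p t) \<bullet> v t \<ge> 0"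
    and e: "0 < e" "e \<le> 1"
  shows "real (card {t \<in> {1..T}. (w - p t) \<bullet> v t \<ge> e})
          \<le> 2 * (2 * real d) ^ d * (real d * ln (65 * real d ^ 2 / e))"
proof -
  \<comment> \<open>This \<open>r\<close> turns the loss bound \<open>e\<close> into the gap
    \<open>8 * d * r\<close> required by \<open>grid_nbhd_cut\<close>.\<close>
  define r where "r = e / (8 * real d)"
  define h where "h = r / (2 * real d)"
  define Q where "Q = 2 * (2 * real d) ^ d"
  define K where "K = knowledge d p v"
  define N where "N t = real (card (grid_nbhd d h r (K t)))" for t
  have r0: "r > 0" and r1: "r \<le> 1" and h0: "h > 0"
    using d e by (auto simp: r_def h_def field_simps)
  have Q0: "Q \<ge> 1" using one_le_power[of "2 * real d" d] d unfolding Q_def by linarith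
  have Kc: "K t \<subseteq> carrier_vec d" for t
    using knowledge_subset_unit_ball unit_ball_subset_carrier unfolding K_def by blast
  \<comment> \<open>Nonnegative losses mean that no cut removes \<open>w\<close>. The range includes
    \<open>Suc T\<close> because the potential is also evaluated after the last round.\<close>
  have wK: "w \<in> K t" if "t \<in> {1..Suc T}" for t
    using w rounds that by (auto simp: K_def knowledge_def)
  have fin: "finite (grid_nbhd d h r (K t))" for t
    using grid_nbhd_unit_ball(1)[OF h0 r1, of d] grid_nbhd_mono[OF knowledge_subset_unit_ball]
    unfolding K_def by (rule rev_finite_subset)
  have N1: "N t \<ge> 1" if "t \<in> {1..Suc T}" for t
  proof -
    have "grid_nbhd d h r (K t) \<noteq> {}"
      using wK[OF that] Kc[of t] h0 d r0 by (intro grid_nbhd_nonempty[of w]) (auto simp: h_def)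
    then show ?thesis using fin[of t] by (simp add: N_def Suc_le_eq card_gt_0_iff)
  qed
  have step: "ln (N (Suc t)) + (if (w - p t) \<bullet> v t \<ge> e then 1 / Q else 0) \<le> ln (N t)"
    if t: "t \<in> {1..T}" for t
  proof -
    have Suc: "K (Suc t) = {k \<in> K t. (k - p t) \<bullet> v t \<ge> 0}"
      using t knowledge_Suc by (simp add: K_def)
    have sub: "grid_nbhd d h r (K (Suc t)) \<subseteq> grid_nbhd d h r (K t)"
      by (rule grid_nbhd_mono) (auto simp: Suc)
    have le: "N (Suc t) \<le> N t" using card_mono[OF fin sub] by (simp add: N_def)
    have pos: "N t \<ge> 1" "N (Suc t) \<ge> 1" using N1 t by auto
    show ?thesis
    proof (cases "(w - p t) \<bullet> v t \<ge> e")
      case True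
      have "card (grid_nbhd d h r (K t)) \<le> 2 * (2 * d) ^ d *
              card (grid_nbhd d h r (K t) - grid_nbhd d h r (K (Suc t)))"
        unfolding Suc
        by (rule grid_nbhd_cut[OF d r0 h_def Kc _ fin wK])
          (use rounds[OF t] t True d in \<open>auto simp: r_def K_def\<close>)
      then have "N t \<le> real (2 * (2 * d) ^ d *
              card (grid_nbhd d h r (K t) - grid_nbhd d h r (K (Suc t))))"
        unfolding N_def of_nat_le_iff .
      also have "card (grid_nbhd d h r (K t) - grid_nbhd d h r (K (Suc t))) =
                 card (grid_nbhd d h r (K t)) - card (grid_nbhd d h r (K (Suc t)))"
        using sub fin by (intro card_Diff_subset) auto
      finally have "N t \<le> Q * (N t - N (Suc t))"
        using le by (simp add: Q_def N_def of_nat_diff)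
      then have "N (Suc t) / N t \<le> 1 - 1 / Q"
        using pos Q0 by (simp add: field_simps)
      \<comment> \<open>\<open>ln x \<le> x - 1\<close> converts the multiplicative loss into an
        additive one that telescopes.\<close>
      moreover have "ln (N (Suc t) / N t) \<le> N (Suc t) / N t - 1"
        using pos by (intro ln_le_minus_one) auto
      ultimately have "ln (N (Suc t)) - ln (N t) \<le> - (1 / Q)"
        using pos by (simp add: ln_div)
      then show ?thesis using True by simp
    next
      case False
      then show ?thesis using le pos by simp
    qed
  qed
  have tel: "ln (N (Suc n)) + real (card {t \<in> {1..n}. (w - p t) \<bullet> v t \<ge> e}) / Q \<le> ln (N 1)"
    if "n \<le> T" for n
    using that
  proof (induction n)
    case (Suc n)
    have "{t \<in> {1..Suc n}. (w - p t) \<bullet> v t \<ge> e} =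
          (if (w - p (Suc n)) \<bullet> v (Suc n) \<ge> e then insert (Suc n) else id)
            {t \<in> {1..n}. (w - p t) \<bullet> v t \<ge> e}"
      by (auto simp: le_Suc_eq)
    then have "real (card {t \<in> {1..Suc n}. (w - p t) \<bullet> v t \<ge> e}) / Q =
        real (card {t \<in> {1..n}. (w - p t) \<bullet> v t \<ge> e}) / Q +
        (if (w - p (Suc n)) \<bullet> v (Suc n) \<ge> e then 1 / Q else 0)"
      by (simp add: add_divide_distrib)
    then show ?case using Suc.IH Suc.prems step[of "Suc n"] by simp
  qed simp
  have "ln (N 1) \<le> real d * ln (65 * real d ^ 2 / e)"
  proof -
    have "N 1 \<le> (4 / h + 1) ^ d"
      using grid_nbhd_unit_ball(2)[OF h0 r1, of d] by (simp add: N_def K_def knowledge_def)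
    \<comment> \<open>Here \<open>4 / h\<close> equals \<open>64 d^2 / e\<close>, and the remaining
      1 is at most \<open>d^2 / e\<close>.\<close>
    also have "4 / h + 1 \<le> 65 * real d ^ 2 / e"
    proof -
      have "1 * e \<le> real d ^ 2 * 1" using d e by (intro mult_mono) auto
      then show ?thesis using d e by (simp add: h_def r_def field_simps power2_eq_square)
    qed
    then have "(4 / h + 1) ^ d \<le> (65 * real d ^ 2 / e) ^ d"
      using h0 by (intro power_mono) auto
    finally have "ln (N 1) \<le> ln ((65 * real d ^ 2 / e) ^ d)" using N1[of 1] by simp
    then show ?thesis using d e by (simp add: ln_realpow)
  qed
  moreover have "ln (N (Suc T)) \<ge> 0" using N1[of "Suc T"] by simp
  ultimately have "real (card {t \<in> {1..T}. (w - p t) \<bullet> v t \<ge> e}) / Q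
      \<le> real d * ln (65 * real d ^ 2 / e)"
    using tel[of T] by linarith
  then show ?thesis using Q0 by (simp add: Q_def field_simps)
qed

section \<open>Summation over scales and the final constant\<close>

text \<open>Growth linear in \<open>i\<close> is what matters: weighted by \<open>2 / 2 ^ i\<close>
  it has bounded sum.\<close>

lemma ln_scale_bound:
  assumes "d \<ge> (1::nat)"
  shows "ln (65 * real d ^ 2 / (1 / 2 ^ i)) \<le> 7 * real d * (real i + 1)"
proof -
  have "ln (65::real) \<le> 5"
  proof -
    \<comment> \<open>The quadratic Taylor bound gives \<open>exp 1 \<ge> 5/2\<close>, and
      \<open>(5/2)^5\<close> exceeds 65.\<close>
    have "(65::real) \<le> (1 + 1 + 1\<^sup>2 / 2) ^ 5" by (simp add: power_divide)
    also have "\<dots> \<le> exp 1 ^ 5" using exp_lower_Taylor_quadratic[of 1] by (intro power_mono) auto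
    also have "\<dots> = exp 5" by (simp add: exp_of_nat_mult[symmetric])
    finally have "ln (65::real) \<le> ln (exp 5)" by (intro ln_mono) auto
    then show ?thesis by simp
  qed
  moreover have "ln (real d) \<le> real d - 1" using assms by (intro ln_le_minus_one) auto
  moreover have "ln (2::real) \<le> 1" using ln_le_minus_one[of 2] by simp
  then have "real i * ln 2 \<le> real i * 1" by (intro mult_left_mono) auto
  moreover have "ln (65 * real d ^ 2 / (1 / 2 ^ i)) = ln 65 + 2 * ln (real d) + real i * ln 2"
    using assms by (simp add: ln_mult ln_realpow)
  ultimately have "ln (65 * real d ^ 2 / (1 / 2 ^ i)) \<le> 3 + 2 * real d + real i" by linarith
  also have "\<dots> \<le> 7 * real d + 7 * real d * real i"
    using assms mult_right_mono[of 1 "real d" "real i"] by simp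
  finally show ?thesis by (simp add: algebra_simps)
qed

lemma regret_bound:
  fixes d T :: nat
  assumes d: "d \<ge> 1" and w: "w \<in> unit_ball d"
    and rounds: "\<And>t. t \<in> {1..T} \<Longrightarrow> john_center d (knowledge d p v t) (p t) \<and>
                  v t \<in> carrier_vec d \<and> vnorm (v t) = 1 \<and> (w - p t) \<bullet> v t \<ge> 0"
  shows "regret T w p v \<le> 1 + 112 * real d ^ 2 * (2 * real d) ^ d"
proof -
  let ?l = "\<lambda>t. (w - p t) \<bullet> v t"
  let ?B = "14 * real d ^ 2 * (2 * real d) ^ d"
  \<comment> \<open>The scales stop once \<open>2 ^ M\<close> exceeds \<open>T\<close>, so the
    uncovered remainders of all rounds add up to at most 1.\<close>
  obtain M where M: "real T < 2 ^ M" using real_arch_pow[of 2 "real T"] by auto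
  have l2: "?l t \<le> 2" if t: "t \<in> {1..T}" for t
  proof -
    have wc: "w \<in> carrier_vec d" "vnorm w \<le> 1" using w by (auto simp: unit_ball_def cball_d_def)
    have john: "john_center d (knowledge d p v t) (p t)" and pc: "p t \<in> carrier_vec d"
      using rounds[OF t] by (auto simp: john_center_def)
    have wk: "w \<in> knowledge d p v t" using w rounds t by (auto simp: knowledge_def)
    \<comment> \<open>Zero coefficients show that the center itself lies in the knowledge set, hence
      in the unit ball; this gives the bound 2 needed by \<open>dyadic_bound\<close>.\<close>
    have "p t + (0 \<cdot>\<^sub>v (w - p t) + 0 \<cdot>\<^sub>v (w - p t)) \<in> knowledge d p v t"
      using knowledge_subset_unit_ball unit_ball_subset_carrier
      by (intro john_center_combination[OF john _ wk wk]) (blast, simp)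
    also have "p t + (0 \<cdot>\<^sub>v (w - p t) + 0 \<cdot>\<^sub>v (w - p t)) = p t"
      using wc pc by (intro eq_vecI) auto
    finally have "vnorm (p t) \<le> 1"
      using pc by (auto simp: knowledge_def unit_ball_def cball_d_def)
    moreover have "w - p t = w + (-1) \<cdot>\<^sub>v p t" using wc pc by (intro eq_vecI) auto
    ultimately have "vnorm (w - p t) \<le> 2"
      using vnorm_add_le[of w d "(-1) \<cdot>\<^sub>v p t"] vnorm_smult[OF pc, of "-1"] wc pc by simp
    then show ?thesis
      using scalar_prod_le_vnorm[of "w - p t" d "v t"] rounds[OF t] wc pc by simp
  qed
  have cnt: "real (card {t \<in> {1..T}. ?l t \<ge> 1 / 2 ^ i}) \<le> ?B * (real i + 1)" for i
  proof -
    have "real (card {t \<in> {1..T}. ?l t \<ge> 1 / 2 ^ i})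
        \<le> 2 * (2 * real d) ^ d * (real d * ln (65 * real d ^ 2 / (1 / 2 ^ i)))"
      by (rule card_large_losses[OF d w rounds]) auto
    also have "\<dots> \<le> 2 * (2 * real d) ^ d * (real d * (7 * real d * (real i + 1)))"
      using ln_scale_bound[OF d] by (intro mult_left_mono) auto
    also have "\<dots> = ?B * (real i + 1)" by (simp add: power2_eq_square)
    finally show ?thesis .
  qed
  have "regret T w p v \<le>
      (\<Sum>t=1..T. (\<Sum>i\<le>M. if ?l t \<ge> 1 / 2 ^ i then 2 / 2 ^ i else 0) + 1 / 2 ^ M)"
    unfolding regret_def using l2 by (intro sum_mono dyadic_bound) auto
  also have "\<dots> = (\<Sum>i\<le>M. \<Sum>t=1..T. if ?l t \<ge> 1 / 2 ^ i then 2 / 2 ^ i else 0) + real T / 2 ^ M"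
    by (subst sum.swap) (simp add: sum.distrib)
  also have "(\<Sum>i\<le>M. \<Sum>t=1..T. if ?l t \<ge> 1 / 2 ^ i then 2 / 2 ^ i else (0::real)) =
      (\<Sum>i\<le>M. real (card {t \<in> {1..T}. ?l t \<ge> 1 / 2 ^ i}) * (2 / 2 ^ i))"
    by (intro sum.cong refl) (simp add: sum.If_cases Int_def)
  also have "\<dots> \<le> (\<Sum>i\<le>M. ?B * (real i + 1) * (2 / 2 ^ i))"
    using cnt by (intro sum_mono mult_right_mono) auto
  also have "\<dots> = ?B * (\<Sum>i\<le>M. (real i + 1) * 2 / 2 ^ i)"
    by (simp add: sum_distrib_left mult.assoc)
  also have "\<dots> \<le> ?B * 8" using sum_power_half by (intro mult_left_mono) auto
  also have "real T / 2 ^ M \<le> 1" using M by simp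
  finally show ?thesis by simp
qed

lemma regret_bound_le_exp:
  assumes d: "d \<ge> (1::nat)"
  shows "1 + 112 * real d ^ 2 * (2 * real d) ^ d \<le> exp (8 * (real d * (1 + ln (real d))))"
proof -
  have l: "ln (real d) \<ge> 0" using d by simp
  have "(113::real) \<le> (1 + 1 + 1\<^sup>2 / 2) ^ 6" by (simp add: power_divide)
  also have "\<dots> \<le> exp 1 ^ 6" using exp_lower_Taylor_quadratic[of 1] by (intro power_mono) auto
  also have "\<dots> = exp 6" by (simp add: exp_of_nat_mult[symmetric])
  finally have c: "(113::real) \<le> exp 6" .
  have two: "(2::real) \<le> exp 1" using exp_ge_add_one_self[of 1] by simp
  have "1 * 1 \<le> real d ^ 2 * (2 * real d) ^ d"
    using d by (intro mult_mono one_le_power) auto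
  \<comment> \<open>The product is at least 1, so the additive 1 is absorbed by raising 112 to
    113.\<close>
  then have "1 + 112 * real d ^ 2 * (2 * real d) ^ d \<le> 113 * (real d ^ 2 * (2 * real d) ^ d)"
    by linarith
  also have "\<dots> \<le> exp 6 * (exp (ln (real d)) ^ 2 * (exp 1 * exp (ln (real d))) ^ d)"
    using c two d by (intro mult_mono power_mono) auto
  also have "\<dots> = exp (6 + 2 * ln (real d) + real d * (1 + ln (real d)))"
    by (simp only: exp_add exp_double exp_of_nat_mult mult.assoc)
  also have "\<dots> \<le> exp (8 * (real d * (1 + ln (real d))))"
  proof -
    \<comment> \<open>The constant and the factor \<open>d^2\<close> cost 7 units of
      \<open>d * (1 + ln d)\<close>, and the power \<open>(2d)^d\<close> costs the eighth.\<close>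
    have "6 + 2 * ln (real d) \<le> 7 * (1 * (1 + ln (real d)))" using l by simp
    also have "\<dots> \<le> 7 * (real d * (1 + ln (real d)))"
      using d l by (intro mult_left_mono mult_right_mono) auto
    finally show ?thesis by simp
  qed
  finally show ?thesis .
qed

text \<open>The exponent uses \<open>1 + ln d\<close> because \<open>ln d\<close> vanishes at
  \<open>d = 1\<close>; for \<open>d \<ge> 2\<close> the two forms agree up to a constant
  factor.\<close>

theorem theorem4p2:
  shows "\<exists>C::real. \<forall>d::nat. \<forall>T::nat. \<forall>w p v.
     d \<ge> 1 \<longrightarrow> w \<in> unit_ball d \<longrightarrow>
     (\<forall>t\<in>{1..T}. john_center d (knowledge d p v t) (p t) \<and>
                  v t \<in> carrier_vec d \<and> vnorm (v t) = 1 \<and>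
                  w \<bullet> v t \<ge> p t \<bullet> v t) \<longrightarrow>
     regret T w p v \<le> exp (C * (real d * (1 + ln (real d))))"
proof (intro exI[of _ 8] allI impI)
  fix d T :: nat and w p v
  assume d: "d \<ge> 1" and w: "w \<in> unit_ball d"
    and *: "\<forall>t\<in>{1..T}. john_center d (knowledge d p v t) (p t) \<and>
                  v t \<in> carrier_vec d \<and> vnorm (v t) = 1 \<and> w \<bullet> v t \<ge> p t \<bullet> v t"
  have "regret T w p v \<le> 1 + 112 * real d ^ 2 * (2 * real d) ^ d"
  proof (rule regret_bound[OF d w])
    fix t assume "t \<in> {1..T}"
    then have t: "john_center d (knowledge d p v t) (p t)" "v t \<in> carrier_vec d"
      "vnorm (v t) = 1" "w \<bullet> v t \<ge> p t \<bullet> v t" using * by auto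
    moreover have "(w - p t) \<bullet> v t = w \<bullet> v t - p t \<bullet> v t"
      using t w unit_ball_subset_carrier
      by (intro minus_scalar_prod_distrib[of _ d]) (auto simp: john_center_def)
    ultimately show "john_center d (knowledge d p v t) (p t) \<and>
        v t \<in> carrier_vec d \<and> vnorm (v t) = 1 \<and> (w - p t) \<bullet> v t \<ge> 0" by simp
  qed
  also have "\<dots> \<le> exp (8 * (real d * (1 + ln (real d))))" by (rule regret_bound_le_exp[OF d])
  finally show "regret T w p v \<le> exp (8 * (real d * (1 + ln (real d))))" .
qed

end
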